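(* Let $p$ be an odd prime with $p\equiv 1\pmod 4$. Then $$\frac{(1/2)_{(p-1)/4}^2}{\big(((p-1)/4)!\big)^2}\left\{1-\frac{p^2}{8}H_{(p-1)/4}^{(2)}\right\}\equiv-\Gamma_p(1/4)^4\pmod{p^3}.$$
   Context: The shifted factorial is $(x)_0=1$ and $(x)_m=x(x+1)\cdots(x+m-1)$ for $m\ge1$. The harmonic numbers of order $2$ are $H_m^{(2)}=\sum_{k=1}^m \frac{1}{k^2}$. $\Gamma_p:\mathbb{Z}_p\to\mathbb{Z}_p^\times$ is (Morita's) $p$-adic Gamma function for the odd prime $p$: the unique continuous function on $\mathbb{Z}_p$ with $\Gamma_p(0)=1$ and $\Gamma_p(m)=(-1)^m\prod_{1\le j<m,\ p\nmid j}j$ for integers $m\ge 1$ (empty product equal to $1$). The congruence is in the ring $\mathbb{Z}_p$ of $p$-adic integers, i.e. the difference of the two sides lies in $p^3\mathbb{Z}_p$. *)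

theory Defs
  imports
    "HOL-Algebra.QuotRing"
    "HOL-Analysis.Function_Topology"
    "HOL-Number_Theory.Modular_Inverse"
begin

text \<open>
  The ring of \<open>p\<close>-adic integers as the inverse limit of the rings \<open>\<int>/p^n\<int>\<close>: an element \<open>x\<close> is
  a compatible family of residues, \<open>x n \<in> {0..<p^n}\<close> being its reduction modulo \<open>p^n\<close>.
\<close>

definition padic_int_ring :: "nat \<Rightarrow> (nat \<Rightarrow> int) ring" where
  "padic_int_ring p =
     \<lparr> carrier = {x. \<forall>n. x n \<in> {0..<int p ^ n} \<and> x (Suc n) mod int p ^ n = x n},
       monoid.mult = (\<lambda>x y n. (x n * y n) mod int p ^ n),
       one = (\<lambda>n. 1 mod int p ^ n),
       zero = (\<lambda>n. 0),
       add = (\<lambda>x y n. (x n + y n) mod int p ^ n) \<rparr>"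

text \<open>
  The canonical map from the rationals with denominator prime to \<open>p\<close> to the \<open>p\<close>-adic integers.
  Its value is meaningless if \<open>p\<close> divides the denominator.
\<close>

definition padic_of_rat :: "nat \<Rightarrow> rat \<Rightarrow> nat \<Rightarrow> int" where
  "padic_of_rat p q =
     (\<lambda>n. (fst (quotient_of q) * modular_inverse (int p ^ n) (snd (quotient_of q))) mod int p ^ n)"

definition padic_cong :: "nat \<Rightarrow> nat \<Rightarrow> (nat \<Rightarrow> int) \<Rightarrow> (nat \<Rightarrow> int) \<Rightarrow> bool" where
  "padic_cong p k x y \<longleftrightarrow>
     x \<ominus>\<^bsub>padic_int_ring p\<^esub> y \<in> PIdl\<^bsub>padic_int_ring p\<^esub> (padic_of_rat p (of_nat (p ^ k)))"

text \<open>
  Continuity is with respect to the instance of the class of topological spaces for functions,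
  that is, the product topology of the discrete spaces \<open>int\<close>; on the carrier this is the inverse
  limit topology, hence the \<open>p\<close>-adic one. Membership in the extensional function space fixes the
  irrelevant values outside the carrier, so that the function is unique as a HOL function.
\<close>

definition is_padic_Gamma :: "nat \<Rightarrow> ((nat \<Rightarrow> int) \<Rightarrow> (nat \<Rightarrow> int)) \<Rightarrow> bool" where
  "is_padic_Gamma p G \<longleftrightarrow>
     G \<in> carrier (padic_int_ring p) \<rightarrow>\<^sub>E Units (padic_int_ring p) \<and>
     continuous_on (carrier (padic_int_ring p)) G \<and>
     G \<zero>\<^bsub>padic_int_ring p\<^esub> = \<one>\<^bsub>padic_int_ring p\<^esub> \<and>
     (\<forall>m::nat. m \<ge> 1 \<longrightarrow>
        G (padic_of_rat p (of_nat m)) =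
          padic_of_rat p ((- 1) ^ m * (\<Prod>j | 1 \<le> j \<and> j < m \<and> \<not> p dvd j. of_nat j)))"

definition padic_Gamma :: "nat \<Rightarrow> (nat \<Rightarrow> int) \<Rightarrow> (nat \<Rightarrow> int)" where
  "padic_Gamma p = (THE G. is_padic_Gamma p G)"

definition harmonic2 :: "nat \<Rightarrow> rat" where
  "harmonic2 m = (\<Sum>k=1..m. 1 / of_nat k ^ 2)"

lemma padic_mod_mod:
  fixes a :: int shows "a mod int p ^ Suc n mod int p ^ n = a mod int p ^ n"
  by (rule mod_mod_cancel) (simp add: le_imp_power_dvd)

lemma padic_carrierI:
  assumes "p > 0" "\<And>n. [f (Suc n) = f n] (mod int p ^ n)"
  shows "(\<lambda>n. f n mod int p ^ n) \<in> carrier (padic_int_ring p)"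
  using assms by (simp add: padic_int_ring_def padic_mod_mod cong_def del: power_Suc)

lemma padic_carrier_cong:
  assumes "x \<in> carrier (padic_int_ring p)"
  shows "[x (Suc n) = x n] (mod int p ^ n)"
proof -
  have "x (Suc n) mod int p ^ n = x n" using assms by (simp add: padic_int_ring_def)
  thus ?thesis by (metis cong_def mod_mod_trivial)
qed

lemma padic_carrier_mod:
  assumes "x \<in> carrier (padic_int_ring p)"
  shows "x n mod int p ^ n = x n"
  using assms by (auto simp: padic_int_ring_def)

lemma cring_padic_int_ring:
  assumes "p > 0"
  shows "cring (padic_int_ring p)"
proof (rule cringI)
  let ?R = "padic_int_ring p"
  have add: "(x \<oplus>\<^bsub>?R\<^esub> y) = (\<lambda>n. (x n + y n) mod int p ^ n)" for x y
    by (simp add: padic_int_ring_def)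
  have mult: "(x \<otimes>\<^bsub>?R\<^esub> y) = (\<lambda>n. (x n * y n) mod int p ^ n)" for x y
    by (simp add: padic_int_ring_def)
  have zero: "\<zero>\<^bsub>?R\<^esub> = (\<lambda>n. 0 mod int p ^ n)" and one: "\<one>\<^bsub>?R\<^esub> = (\<lambda>n. 1 mod int p ^ n)"
    by (simp_all add: padic_int_ring_def)
  have add_closed: "x \<oplus>\<^bsub>?R\<^esub> y \<in> carrier ?R" if "x \<in> carrier ?R" "y \<in> carrier ?R" for x y
    unfolding add using that assms by (intro padic_carrierI cong_add padic_carrier_cong)
  have mult_closed: "x \<otimes>\<^bsub>?R\<^esub> y \<in> carrier ?R" if "x \<in> carrier ?R" "y \<in> carrier ?R" for x y
    unfolding mult using that assms by (intro padic_carrierI cong_mult padic_carrier_cong)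
  have zero_closed: "\<zero>\<^bsub>?R\<^esub> \<in> carrier ?R"
    unfolding zero using assms by (intro padic_carrierI) auto
  have one_closed: "\<one>\<^bsub>?R\<^esub> \<in> carrier ?R"
    unfolding one using assms by (intro padic_carrierI) auto
  have inv: "\<exists>y\<in>carrier ?R. y \<oplus>\<^bsub>?R\<^esub> x = \<zero>\<^bsub>?R\<^esub>" if "x \<in> carrier ?R" for x
  proof
    show "(\<lambda>n. (- x n) mod int p ^ n) \<in> carrier ?R"
      using that assms by (intro padic_carrierI)
        (simp_all add: cong_minus_minus_iff padic_carrier_cong)
    show "(\<lambda>n. (- x n) mod int p ^ n) \<oplus>\<^bsub>?R\<^esub> x = \<zero>\<^bsub>?R\<^esub>"
      by (simp add: add zero mod_simps)
  qed
  show "abelian_group ?R"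
  proof (rule abelian_groupI)
    show "\<zero>\<^bsub>?R\<^esub> \<oplus>\<^bsub>?R\<^esub> x = x" if "x \<in> carrier ?R" for x
      using padic_carrier_mod[OF that] by (simp add: add zero)
  qed (use add_closed zero_closed inv in \<open>auto simp: add mod_simps algebra_simps\<close>)
  show "Group.comm_monoid ?R"
  proof (rule comm_monoidI)
    show "\<one>\<^bsub>?R\<^esub> \<otimes>\<^bsub>?R\<^esub> x = x" if "x \<in> carrier ?R" for x
      using padic_carrier_mod[OF that] by (simp add: mult one mod_simps)
  qed (use mult_closed one_closed in \<open>auto simp: mult mod_simps algebra_simps\<close>)
  show "(x \<oplus>\<^bsub>?R\<^esub> y) \<otimes>\<^bsub>?R\<^esub> z = x \<otimes>\<^bsub>?R\<^esub> z \<oplus>\<^bsub>?R\<^esub> y \<otimes>\<^bsub>?R\<^esub> z" for x y z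
    by (simp add: add mult mod_simps algebra_simps)
qed

lemma padic_of_rat_of_int:
  "padic_of_rat p (of_int k) = (\<lambda>n. k mod int p ^ n)"
proof
  fix n
  have "[1 * modular_inverse (int p ^ n) 1 = 1] (mod int p ^ n)"
    by (rule cong_modular_inverse1) simp
  hence "[k * modular_inverse (int p ^ n) 1 = k * 1] (mod int p ^ n)"
    by (intro cong_mult) auto
  moreover have "quotient_of (of_int k) = (k, 1)"
    by (simp add: of_int_rat quotient_of_Fract Rat.normalize_def)
  ultimately show "padic_of_rat p (of_int k) n = k mod int p ^ n"
    by (simp add: padic_of_rat_def cong_def)
qed

lemma padic_of_rat_times_denom:
  assumes "coprime (snd (quotient_of q)) (int p)"
  shows "padic_of_rat p q \<otimes>\<^bsub>padic_int_ring p\<^esub> padic_of_rat p (of_int (snd (quotient_of q)))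
           = padic_of_rat p (of_int (fst (quotient_of q)))"
proof
  fix n
  let ?a = "fst (quotient_of q)" and ?b = "snd (quotient_of q)" and ?P = "int p ^ n"
  have "[?b * modular_inverse ?P ?b = 1] (mod ?P)"
    using assms by (intro cong_modular_inverse1) auto
  hence "[?a * (?b * modular_inverse ?P ?b) = ?a * 1] (mod ?P)"
    by (intro cong_mult) auto
  hence "(?a * modular_inverse ?P ?b) * ?b mod ?P = ?a mod ?P"
    by (simp add: cong_def mult_ac)
  thus "(padic_of_rat p q \<otimes>\<^bsub>padic_int_ring p\<^esub> padic_of_rat p (of_int ?b)) n
          = padic_of_rat p (of_int ?a) n"
    unfolding padic_of_rat_of_int
    by (simp add: padic_of_rat_def padic_int_ring_def mod_mult_left_eq mod_mult_right_eq)
qed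

end

theory Submission
  imports Defs "HOL-Number_Theory.Residue_Primitive_Roots"
begin

text \<open>
  Write \<open>p = 4n + 1\<close> and \<open>w = -(p-1)!\<close>. All the analysis is hidden in one remark: on the natural
  numbers \<open>\<Gamma>\<^sub>p(m) mod p^3\<close> depends only on \<open>m mod p^3\<close>, so \<open>\<Gamma>\<^sub>p(1/4)\<close> may be replaced
  by \<open>\<Gamma>\<^sub>p(m)\<close> with \<open>4m = 3p^3 + 1\<close>, and the theorem becomes a congruence between integers.
  Three facts prove it, where \<open>b\<close> is the integer with \<open>m + n = pb\<close>, so that \<open>4b = 3p^2 + 1\<close>.

  First, \<open>\<Gamma>\<^sub>p(ip) \<equiv> w^i\<close> modulo \<open>p^3\<close>: each block \<open>(ip+1)\<cdots>(ip+p-1)\<close> is congruent to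
  \<open>(p-1)!\<close>, because pairing \<open>j\<close> with \<open>p - j\<close> leaves an error \<open>p^2\<close> times
  a multiple of \<open>1/1^2 + \<cdots> + 1/((p-1)/2)^2\<close>, which vanishes modulo \<open>p\<close>. As \<open>w^(p^2) \<equiv> 1\<close>,
  the fourth power at \<open>ip = pb = m + n\<close> is just \<open>w\<close>. Walking down \<open>n\<close> steps from \<open>m + n\<close> to \<open>m\<close>
  gives \<open>\<Gamma>\<^sub>p(m)^4 Q^4 \<equiv> w\<close> with \<open>Q = \<Prod>j\<le>n. (j - pb)\<close>.

  Secondly, \<open>-w = (p-1)! \<equiv> A^2 B^2\<close> for the lower half \<open>A\<close> and the upper half \<open>B\<close> of
  \<open>\<Prod>j\<le>2n. (j - 2pb)\<close>, by the same error estimate, and up to sign \<open>B\<close> is the shifted factorial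
  \<open>(1/2)\<^sub>n\<close>.

  Thirdly, \<open>(j - pb)^2 = j(j - 2pb) + p^2 b^2\<close>, so \<open>Q^2\<close> is \<open>n! A\<close> up to a second-order term
  governed by the harmonic number of order two; since \<open>16 b^2 \<equiv> 1\<close>, this term is what the
  factor \<open>1 - p^2 H/8\<close> cancels. Eliminating \<open>A\<close>, \<open>B\<close> and \<open>Q\<close> yields the claim
  (lemma \<open>padic_Gamma_nat_quarter_fourth_power_cong\<close>).

  Since the \<open>p\<close>-adic Gamma function is given by a definite description, its existence has to be
  proved too. It rests on Wilson's theorem modulo the powers of \<open>p\<close>
  (lemma \<open>prod_totatives_odd_prime_power\<close>); uniqueness holds because the natural numbers are dense.
\<close>

section \<open>Second-order expansions and a harmonic sum\<close>

text \<open>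
  The constant and the linear term in \<open>x\<close> of the product; the sum is the second-last elementary
  symmetric function, written so as to avoid division.
\<close>

lemma prod_add_const_cong:
  fixes a :: "'i \<Rightarrow> int"
  assumes "finite A"
  shows "[(\<Prod>j\<in>A. a j + x) = (\<Prod>j\<in>A. a j) + x * (\<Sum>k\<in>A. \<Prod>j\<in>A - {k}. a j)] (mod x\<^sup>2)"
  using assms
proof (induction A rule: finite_induct)
  case (insert i A)
  let ?P = "\<Prod>j\<in>A. a j" and ?S = "\<Sum>k\<in>A. \<Prod>j\<in>A - {k}. a j"
  have "(\<Prod>j\<in>insert i A - {k}. a j) = a i * (\<Prod>j\<in>A - {k}. a j)" if "k \<in> A" for k
  proof -
    have "insert i A - {k} = insert i (A - {k})" using that insert.hyps by auto
    thus ?thesis using insert.hyps by simp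
  qed
  hence S: "(\<Sum>k\<in>insert i A. \<Prod>j\<in>insert i A - {k}. a j) = ?P + a i * ?S"
    using insert.hyps by (simp add: sum_distrib_left cong: sum.cong)
  have "[(\<Prod>j\<in>insert i A. a j + x) = (a i + x) * (?P + x * ?S)] (mod x\<^sup>2)"
    using insert by (simp add: cong_mult)
  also have "(a i + x) * (?P + x * ?S) = a i * ?P + x * (?P + a i * ?S) + x\<^sup>2 * ?S"
    by (simp add: algebra_simps power2_eq_square)
  also have "[\<dots> = a i * ?P + x * (?P + a i * ?S) + 0] (mod x\<^sup>2)"
    by (intro cong_add cong_refl) (simp add: cong_0_iff)
  finally show ?case using insert.hyps S by simp
qed simp

lemma prod_double_range_reflect:
  fixes g :: "nat \<Rightarrow> 'a :: comm_monoid_mult"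
  shows "(\<Prod>j=1..2*N. g j) = (\<Prod>j=1..N. g j * g (2*N+1-j))"
proof -
  have "(\<Prod>j=1..2*N. g j) = (\<Prod>j=1..N. g j) * (\<Prod>j=N+1..2*N. g j)"
    by (subst prod.union_disjoint [symmetric]) (auto intro!: prod.cong)
  also have "(\<Prod>j=N+1..2*N. g j) = (\<Prod>j=1..N. g (2*N+1-j))"
    by (rule prod.reindex_bij_witness[of _ "\<lambda>j. 2*N+1-j" "\<lambda>j. 2*N+1-j"]) auto
  finally show ?thesis by (simp add: prod.distrib)
qed

lemma sum_double_range_reflect:
  fixes g :: "nat \<Rightarrow> 'a :: comm_monoid_add"
  shows "(\<Sum>j=1..2*N. g j) = (\<Sum>j=1..N. g j + g (2*N+1-j))"
proof -
  have "(\<Sum>j=1..2*N. g j) = (\<Sum>j=1..N. g j) + (\<Sum>j=N+1..2*N. g j)"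
    by (subst sum.union_disjoint [symmetric]) (auto intro!: sum.cong)
  also have "(\<Sum>j=N+1..2*N. g j) = (\<Sum>j=1..N. g (2*N+1-j))"
    by (rule sum.reindex_bij_witness[of _ "\<lambda>j. 2*N+1-j" "\<lambda>j. 2*N+1-j"]) auto
  finally show ?thesis by (simp add: sum.distrib)
qed

lemma sum_squares_formula: "6 * (\<Sum>k=1..n. (int k)\<^sup>2) = int n * (int n + 1) * (2 * int n + 1)"
  by (induction n) (auto simp: algebra_simps power2_eq_square)

lemma coprime_less_prime:
  assumes "prime p" "0 < k" "k < p"
  shows "coprime (int k) (int p)"
proof -
  have "\<not> p dvd k" using assms by (auto dest: dvd_imp_le)
  hence "coprime p k" using assms by (simp add: prime_imp_coprime)
  thus ?thesis by (simp add: coprime_commute)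
qed

text \<open>
  Dividing by \<open>(N!)^2\<close> turns the sum into \<open>\<Sum>k\<le>N. k^(-2)\<close> modulo \<open>p\<close>. As \<open>k\<close> and \<open>p - k\<close> have the
  same square, this is half of the sum over all nonzero residues; inversion permutes these, so
  the latter equals \<open>\<Sum>k<p. k^2\<close>, a multiple of \<open>p\<close> when \<open>p > 3\<close>.
\<close>

lemma prime_dvd_sum_prod_squares:
  fixes p N :: nat
  assumes p: "prime p" "p > 3" "p = 2 * N + 1"
  shows "int p dvd (\<Sum>k=1..N. \<Prod>j\<in>{1..N} - {k}. (int j)\<^sup>2)"
proof -
  \<comment> \<open>\<open>v\<close> is inversion modulo \<open>p\<close> on \<open>{1..p - 1}\<close>.\<close>
  define v where "v k = nat (modular_inverse (int p) (int k))" for k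
  have cop: "coprime (int k) (int p)" if "k \<in> {1..2*N}" for k
    using that p by (intro coprime_less_prime) auto
  have int_v: "int (v k) = modular_inverse (int p) (int k)" for k
    using p by (simp add: v_def modular_inverse_int_nonneg)
  have inv: "[int k * int (v k) = 1] (mod int p)" if "k \<in> {1..2*N}" for k
    unfolding int_v using cop[OF that] by (rule cong_modular_inverse1)
  have vv: "v (v k) = k" if "k \<in> {1..2*N}" for k
  proof -
    have "modular_inverse (int p) (int (v k)) = int k"
      using that inv[OF that] p by (intro modular_inverse_int_eqI) (auto simp: mult.commute)
    thus ?thesis by (simp add: v_def)
  qed
  have v_in: "v k \<in> {1..2*N}" if "k \<in> {1..2*N}" for k
  proof -
    have "0 < int (v k)" unfolding int_v using p cop[OF that]
      by (intro mult_modular_inverse_int_pos) auto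
    moreover have "int (v k) < int p" unfolding int_v using p
      by (intro modular_inverse_int_less) auto
    ultimately show ?thesis using p by auto
  qed
  have v_neg: "[(int (v (2*N+1-k)))\<^sup>2 = (int (v k))\<^sup>2] (mod int p)" if "k \<in> {1..N}" for k
  proof -
    have k: "k \<in> {1..2*N}" "2*N+1-k \<in> {1..2*N}" using that by auto
    have kp: "int (2*N+1-k) = int p - int k" using that p by auto
    let ?v = "int (v k)" and ?v' = "int (v (2*N+1-k))"
    have "[?v' * 1 + ?v * 1 = ?v' * (int k * ?v) + ?v * (int (2*N+1-k) * ?v')] (mod int p)"
      by (intro cong_add cong_mult cong_refl cong_sym[OF inv] k)
    also have "?v' * (int k * ?v) + ?v * (int (2*N+1-k) * ?v') = int p * (?v * ?v')"
      unfolding kp by (simp only: algebra_simps)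
    finally have "int p dvd ?v' + ?v" by (simp add: cong_dvd_iff)
    hence "int p dvd (?v' + ?v) * (?v' - ?v)" by (rule dvd_mult2)
    also have "(?v' + ?v) * (?v' - ?v) = ?v'\<^sup>2 - ?v\<^sup>2" by (simp add: algebra_simps power2_eq_square)
    finally show ?thesis by (simp add: cong_iff_dvd_diff)
  qed
  let ?U = "\<Sum>k=1..N. (int (v k))\<^sup>2"
  have "(\<Sum>k=1..2*N. (int (v k))\<^sup>2) = (\<Sum>k=1..2*N. (int k)\<^sup>2)"
    by (rule sum.reindex_bij_witness[of _ v v]) (use vv v_in in auto)
  also have "(\<Sum>k=1..2*N. (int (v k))\<^sup>2) = (\<Sum>k=1..N. (int (v k))\<^sup>2 + (int (v (2*N+1-k)))\<^sup>2)"
    by (rule sum_double_range_reflect)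
  finally have "[(\<Sum>k=1..2*N. (int k)\<^sup>2) = (\<Sum>k=1..N. (int (v k))\<^sup>2 + (int (v k))\<^sup>2)] (mod int p)"
    using v_neg by (metis (no_types, lifting) cong_add cong_refl cong_sum)
  hence "[6 * (\<Sum>k=1..2*N. (int k)\<^sup>2) = 6 * (2 * ?U)] (mod int p)"
    by (intro cong_mult cong_refl) (simp add: sum_distrib_left)
  moreover have "int p dvd 6 * (\<Sum>k=1..2*N. (int k)\<^sup>2)"
  proof -
    have "int (2*N) + 1 = int p" using p(3) by simp
    thus ?thesis unfolding sum_squares_formula by (simp only: dvd_mult dvd_mult2 dvd_refl)
  qed
  ultimately have "int p dvd 12 * ?U" by (simp add: cong_dvd_iff)
  moreover have "coprime (int p) 12"
  proof -
    have "coprime (int 2) (int p)" "coprime (int 3) (int p)"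
      using p by (intro coprime_less_prime; simp)+
    hence "coprime (2 * 2 * 3) (int p)" by (simp only: coprime_mult_left_iff of_nat_numeral)
    thus ?thesis by (simp add: coprime_commute)
  qed
  ultimately have U: "int p dvd ?U" by (simp add: coprime_dvd_mult_right_iff)
  let ?V = "\<Prod>j=1..N. (int j)\<^sup>2"
  have "[(\<Prod>j\<in>{1..N} - {k}. (int j)\<^sup>2) = ?V * (int (v k))\<^sup>2] (mod int p)" if k: "k \<in> {1..N}" for k
  proof -
    have "?V = (int k)\<^sup>2 * (\<Prod>j\<in>{1..N} - {k}. (int j)\<^sup>2)"
      using k by (subst prod.remove[of _ k]) auto
    hence "?V * (int (v k))\<^sup>2 = (\<Prod>j\<in>{1..N} - {k}. (int j)\<^sup>2) * (int k * int (v k))\<^sup>2"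
      by (simp add: power_mult_distrib)
    also have "[\<dots> = (\<Prod>j\<in>{1..N} - {k}. (int j)\<^sup>2) * 1\<^sup>2] (mod int p)"
      using k by (intro cong_mult cong_refl cong_pow inv) auto
    finally show ?thesis by (simp add: cong_sym)
  qed
  hence "[(\<Sum>k=1..N. \<Prod>j\<in>{1..N} - {k}. (int j)\<^sup>2) = (\<Sum>k=1..N. ?V * (int (v k))\<^sup>2)] (mod int p)"
    by (rule cong_sum)
  also have "(\<Sum>k=1..N. ?V * (int (v k))\<^sup>2) = ?V * ?U" by (simp add: sum_distrib_left)
  finally show ?thesis using U by (simp add: cong_dvd_iff)
qed

text \<open>
  Pair \<open>j\<close> with \<open>p - j\<close>; evenness of \<open>N\<close> absorbs the signs.
\<close>

lemma fact_pred_prime_as_half_product: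
  assumes "p = 2 * N + 1" "even N"
  shows "fact (p - 1) = (\<Prod>j=1..N. int j * (int j - int p))"
proof -
  have "fact (p - 1) = (\<Prod>j=1..2*N. int j)" using assms by (simp add: fact_prod)
  also have "\<dots> = (\<Prod>j=1..N. int j * int (2*N+1-j))" by (rule prod_double_range_reflect)
  also have "\<dots> = (\<Prod>j=1..N. - 1 * (int j * (int j - int p)))"
    using assms by (intro prod.cong refl) (auto simp: algebra_simps of_nat_diff)
  also have "\<dots> = (\<Prod>j=1..N. int j * (int j - int p))"
    using assms by (subst prod.distrib) simp
  finally show ?thesis .
qed

text \<open>
  The linear coefficient in \<open>c p^2\<close> is congruent modulo \<open>p\<close> to the harmonic sum of
  \<open>prime_dvd_sum_prod_squares\<close>, so perturbing all factors by the same multiple of \<open>p^2\<close> is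
  invisible modulo \<open>p^3\<close>.
\<close>

lemma half_product_perturbed_cong:
  assumes p: "prime p" "p > 3" "p = 2 * N + 1" "even N"
  shows "[(\<Prod>j=1..N. int j * (int j - int p) + c * (int p)\<^sup>2) = fact (p - 1)] (mod int p ^ 3)"
proof -
  let ?a = "\<lambda>j. int j * (int j - int p)" and ?x = "c * (int p)\<^sup>2"
  let ?S = "\<Sum>k=1..N. \<Prod>j\<in>{1..N} - {k}. ?a j"
  have "[?S = (\<Sum>k=1..N. \<Prod>j\<in>{1..N} - {k}. (int j)\<^sup>2)] (mod int p)"
  proof (intro cong_sum cong_prod)
    fix j
    have "?a j = (int j)\<^sup>2 + int p * (- int j)" by (simp add: algebra_simps power2_eq_square)
    thus "[?a j = (int j)\<^sup>2] (mod int p)" by (simp only: cong_iff_dvd_diff) simp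
  qed
  with prime_dvd_sum_prod_squares[OF p(1-3)] have "int p dvd ?S" by (simp add: cong_dvd_iff)
  then obtain t where "?S = int p * t" by (elim dvdE)
  hence "?x * ?S = int p ^ 3 * (c * t)" by (simp only: power2_eq_square power3_eq_cube mult_ac)
  hence "int p ^ 3 dvd ?x * ?S" by (metis dvd_triv_left)
  hence "[(\<Prod>j=1..N. ?a j) + ?x * ?S = (\<Prod>j=1..N. ?a j) + 0] (mod int p ^ 3)"
    by (intro cong_add cong_refl) (simp add: cong_0_iff)
  moreover have "int p ^ 3 dvd ?x\<^sup>2"
  proof -
    have "?x\<^sup>2 = int p ^ 3 * (c\<^sup>2 * int p)" by (simp add: power2_eq_square power3_eq_cube)
    thus ?thesis by (metis dvd_triv_left)
  qed
  hence "[(\<Prod>j=1..N. ?a j + ?x) = (\<Prod>j=1..N. ?a j) + ?x * ?S] (mod int p ^ 3)"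
    by (rule cong_dvd_modulus[OF prod_add_const_cong[OF finite_atLeastAtMost]])
  ultimately have "[(\<Prod>j=1..N. ?a j + ?x) = (\<Prod>j=1..N. ?a j) + 0] (mod int p ^ 3)"
    by (rule cong_trans[rotated])
  thus ?thesis by (simp only: fact_pred_prime_as_half_product[OF p(3,4)] add_0_right)
qed

section \<open>Morita's function on the natural numbers\<close>

text \<open>
  The prescribed values of the \<open>p\<close>-adic Gamma function at natural numbers. At \<open>0\<close> the formula gives
  \<open>1\<close>, so the normalisation at \<open>0\<close> needs no separate case.
\<close>

definition padic_Gamma_nat :: "nat \<Rightarrow> nat \<Rightarrow> int" where
  "padic_Gamma_nat p m = (-1) ^ m * (\<Prod>j | 1 \<le> j \<and> j < m \<and> \<not> p dvd j. int j)"

lemma padic_Gamma_nat_0 [simp]: "padic_Gamma_nat p 0 = 1"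
  by (simp add: padic_Gamma_nat_def)

lemma padic_Gamma_nat_Suc: "padic_Gamma_nat p (Suc m) = - padic_Gamma_nat p m * (if p dvd m then 1 else int m)"
proof (cases "p dvd m")
  case True
  hence "{j. 1 \<le> j \<and> j < Suc m \<and> \<not> p dvd j} = {j. 1 \<le> j \<and> j < m \<and> \<not> p dvd j}"
    by (auto simp: less_Suc_eq)
  with True show ?thesis by (simp add: padic_Gamma_nat_def)
next
  case False
  hence "{j. 1 \<le> j \<and> j < Suc m \<and> \<not> p dvd j} = insert m {j. 1 \<le> j \<and> j < m \<and> \<not> p dvd j}"
    by (cases "m = 0") (auto simp: less_Suc_eq)
  with False show ?thesis by (simp add: padic_Gamma_nat_def)
qed

lemma padic_Gamma_nat_add:
  "padic_Gamma_nat p (m + k) = padic_Gamma_nat p m * (\<Prod>i<k. - (if p dvd m + i then 1 else int (m + i)))"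
  by (induction k) (simp_all add: padic_Gamma_nat_Suc algebra_simps)

lemma coprime_padic_Gamma_nat:
  assumes "prime p"
  shows "coprime (padic_Gamma_nat p m) (int p)"
proof (induction m)
  case (Suc m)
  have "coprime (int m) (int p)" if "\<not> p dvd m"
    using prime_imp_coprime[OF assms that] by (simp add: coprime_commute)
  with Suc show ?case by (simp add: padic_Gamma_nat_Suc)
qed simp

text \<open>
  Wilson's theorem for odd prime powers. In terms of a primitive root \<open>g\<close> and \<open>t = \<phi>(p^k)\<close> the product is
  \<open>g^(t(t-1)/2)\<close>; here \<open>g^(t/2)\<close> is a square root of \<open>1\<close> other than \<open>1\<close>, hence \<open>-1\<close>, and
  \<open>t - 1\<close> is odd.
\<close>

lemma prod_totatives_odd_prime_power:
  assumes p: "prime p" "odd p" and k: "k > 0"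
  shows "[(\<Prod>j\<in>totatives (p ^ k). int j) = - 1] (mod int (p ^ k))"
proof -
  define M where "M = p ^ k"
  obtain g where "residue_primroot M g"
    using residue_primroot_odd_prime_power_exists[OF p] k unfolding M_def by metis
  hence g: "coprime M g" "ord M g = totient M" by (auto simp: residue_primroot_def)
  have "p > 2" using p prime_ge_2_nat[of p] by (cases "p = 2") auto
  hence "M > 2" unfolding M_def using self_le_power[of p k] k by simp
  hence "even (totient M)" by (intro totient_even)
  then obtain s where s: "totient M = 2 * s" by (elim evenE)
  have "totient M > 0" using \<open>M > 2\<close> by simp
  hence "s > 0" using s by simp
  define h where "h = int g ^ s"
  have "[g ^ totient M = 1] (mod M)" by (metis g(2) ord_divides dvd_refl)
  hence "[int (g ^ totient M) = int 1] (mod int M)" by (subst cong_int_iff)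
  hence "[h ^ 2 = 1] (mod int M)" by (simp add: h_def s mult.commute flip: power_mult)
  hence "int M dvd h ^ 2 - 1" by (simp add: cong_iff_dvd_diff)
  hence dvd: "int p ^ k dvd (h - 1) * (h + 1)"
    by (simp add: M_def algebra_simps power2_eq_square)
  \<comment> \<open>\<open>p > 2\<close> divides at most one of \<open>h - 1\<close> and \<open>h + 1\<close>, so \<open>p^k\<close> divides one of them entirely.\<close>
  have not_dvd: "\<not> int p ^ k dvd h - 1"
  proof
    assume "int p ^ k dvd h - 1"
    hence "[int (g ^ s) = int 1] (mod int M)" by (simp add: cong_iff_dvd_diff h_def M_def)
    hence "[g ^ s = 1] (mod M)" by (subst (asm) cong_int_iff)
    hence "ord M g dvd s" by (simp only: ord_divides)
    with g s \<open>s > 0\<close> show False by (auto dest: dvd_imp_le)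
  qed
  have prime: "prime (int p)" using p by simp
  have "int p ^ k dvd h + 1"
  proof (cases "int p dvd h - 1")
    case True
    have "\<not> int p dvd h + 1"
    proof
      assume "int p dvd h + 1"
      hence "int p dvd (h + 1) - (h - 1)" using True by (rule dvd_diff)
      hence "int p \<le> 2" by (auto dest: zdvd_imp_le)
      thus False using \<open>p > 2\<close> by simp
    qed
    hence "coprime (int p ^ k) (h + 1)" using prime by (simp add: prime_imp_coprime)
    hence "int p ^ k dvd h - 1" using dvd by (simp add: coprime_dvd_mult_left_iff)
    thus ?thesis using not_dvd by contradiction
  next
    case False
    hence "coprime (int p ^ k) (h - 1)" using prime by (simp add: prime_imp_coprime)
    thus ?thesis using dvd by (simp add: coprime_dvd_mult_right_iff)
  qed
  hence h: "[h = - 1] (mod int M)" by (simp add: cong_iff_dvd_diff M_def)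
  have "(\<Prod>j\<in>totatives M. int j) = (\<Prod>i<totient M. int (g ^ i mod M))"
    using residue_primroot_is_generator[of M g] \<open>M > 2\<close> \<open>residue_primroot M g\<close>
    by (intro prod.reindex_bij_betw [symmetric]) auto
  also have "[\<dots> = (\<Prod>i<totient M. int g ^ i)] (mod int M)"
    by (intro cong_prod) (simp add: cong_def zmod_int)
  also have "(\<Prod>i<totient M. int g ^ i) = int g ^ (\<Sum>i<totient M. i)"
    by (simp add: power_sum)
  also have "(\<Sum>i<totient M. i) = s * (totient M - 1)"
  proof -
    have "(\<Sum>i<totient M. i) = (totient M * (totient M - 1)) div 2"
      by (metis Sum_Ico_nat atLeast0LessThan diff_zero mult_0 )
    thus ?thesis by (simp add: s)
  qed
  also have "int g ^ (s * (totient M - 1)) = h ^ (totient M - 1)" by (simp add: h_def power_mult)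
  also have "[\<dots> = (- 1) ^ (totient M - 1)] (mod int M)" by (intro cong_pow h)
  also have "(- 1 :: int) ^ (totient M - 1) = - 1" using s \<open>s > 0\<close> by simp
  finally show ?thesis by (simp add: M_def)
qed

lemma padic_Gamma_nat_prime_power:
  assumes p: "prime p" "odd p"
  shows "[padic_Gamma_nat p (p ^ k) = 1] (mod int p ^ k)"
proof (cases "k = 0")
  case False
  have "j \<in> totatives (p ^ k) \<longleftrightarrow> 1 \<le> j \<and> j < p ^ k \<and> \<not> p dvd j" for j
  proof -
    have "coprime j (p ^ k) \<longleftrightarrow> \<not> p dvd j" using False p
      by (metis coprime_commute coprime_power_right_iff not_prime_unit prime_imp_coprime
            coprime_common_divisor dvd_refl neq0_conv)
    moreover have "p dvd p ^ k" using False by simp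
    ultimately show ?thesis by (auto simp: totatives_def order_le_less)
  qed
  hence "{j. 1 \<le> j \<and> j < p ^ k \<and> \<not> p dvd j} = totatives (p ^ k)" by blast
  moreover have "odd (p ^ k)" using p by simp
  ultimately have "padic_Gamma_nat p (p ^ k) = - (\<Prod>j\<in>totatives (p ^ k). int j)"
    by (simp add: padic_Gamma_nat_def)
  moreover have "[- (\<Prod>j\<in>totatives (p ^ k). int j) = - (- 1)] (mod int (p ^ k))"
    unfolding cong_minus_minus_iff using p False by (intro prod_totatives_odd_prime_power) auto
  ultimately show ?thesis by simp
qed simp

text \<open>
  Only the case \<open>m = 0\<close> needs Wilson's theorem: the recursion in \<open>m\<close> multiplies both sides by
  congruent factors.
\<close>

lemma padic_Gamma_nat_add_prime_power:
  assumes p: "prime p" "odd p"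
  shows "[padic_Gamma_nat p (m + p ^ k) = padic_Gamma_nat p m] (mod int p ^ k)"
proof (cases "k = 0")
  case False
  show ?thesis
  proof (induction m)
    case 0
    show ?case using padic_Gamma_nat_prime_power[OF p] by simp
  next
    case (Suc m)
    have "p dvd m + p ^ k \<longleftrightarrow> p dvd m" using False by (simp add: dvd_add_left_iff)
    hence "[(if p dvd m + p ^ k then 1 else int (m + p ^ k)) = (if p dvd m then 1 else int m)] (mod int p ^ k)"
      by (simp add: cong_iff_dvd_diff)
    hence "[- padic_Gamma_nat p (m + p ^ k) * (if p dvd m + p ^ k then 1 else int (m + p ^ k)) =
            - padic_Gamma_nat p m * (if p dvd m then 1 else int m)] (mod int p ^ k)"
      using Suc by (intro cong_mult) (simp_all only: cong_minus_minus_iff)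
    thus ?case by (simp only: padic_Gamma_nat_Suc add_Suc)
  qed
qed simp

text \<open>
  This is the uniform continuity that lets the function extend to the \<open>p\<close>-adic integers.
\<close>

lemma padic_Gamma_nat_mod_prime_power:
  assumes p: "prime p" "odd p"
  shows "[padic_Gamma_nat p (m mod p ^ k) = padic_Gamma_nat p m] (mod int p ^ k)"
proof -
  have "[padic_Gamma_nat p (r + q * p ^ k) = padic_Gamma_nat p r] (mod int p ^ k)" for r q
  proof (induction q)
    case (Suc q)
    have "[padic_Gamma_nat p (r + q * p ^ k + p ^ k) = padic_Gamma_nat p (r + q * p ^ k)] (mod int p ^ k)"
      by (rule padic_Gamma_nat_add_prime_power[OF p])
    also note Suc
    finally show ?case by (simp add: algebra_simps)
  qed simp
  from this[of "m mod p ^ k" "m div p ^ k"] show ?thesis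
    by (metis cong_sym mod_mult_div_eq mult.commute)
qed

section \<open>Values at multiples of the prime\<close>

text \<open>
  The factors picked up between \<open>ip\<close> and \<open>(i+1)p\<close> are paired as
  \<open>(ip + j)(ip + p - j) = -(j(j - p) - i(i+1)p^2)\<close>, which is a uniform perturbation of the product
  for \<open>(p-1)!\<close>.
\<close>

lemma padic_Gamma_nat_multiple_cong:
  assumes p: "prime p" "p > 3" "p = 2 * N + 1" "even N"
  shows "[padic_Gamma_nat p (i * p) = (- fact (p - 1)) ^ i] (mod int p ^ 3)"
proof (induction i)
  case (Suc i)
  let ?g = "\<lambda>t. if p dvd i * p + t then 1 else int (i * p + t)"
  have "{..<p} = insert 0 {1..2*N}" using p by auto
  hence "(\<Prod>t<p. - ?g t) = - (\<Prod>t=1..2*N. - ?g t)" by simp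
  also have "(\<Prod>t=1..2*N. - ?g t) = (\<Prod>t=1..2*N. - 1 * int (i * p + t))"
  proof (intro prod.cong refl)
    fix t assume "t \<in> {1..2*N}"
    hence "\<not> p dvd t" using p(3) by (auto dest: dvd_imp_le)
    hence "\<not> p dvd i * p + t" by (simp add: dvd_add_right_iff)
    thus "- ?g t = - 1 * int (i * p + t)" by simp
  qed
  also have "\<dots> = (\<Prod>t=1..2*N. int (i * p + t))" by (subst prod.distrib) simp
  also have "\<dots> = (\<Prod>j=1..N. int (i * p + j) * int (i * p + (2*N+1-j)))"
    by (rule prod_double_range_reflect)
  also have "\<dots> = (\<Prod>j=1..N. - 1 * (int j * (int j - int p) + (- (int i * (int i + 1))) * (int p)\<^sup>2))"
  proof (intro prod.cong refl)
    fix j assume "j \<in> {1..N}"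
    hence "int (2*N+1-j) = int p - int j" using p(3) by (simp add: of_nat_diff)
    thus "int (i * p + j) * int (i * p + (2*N+1-j)) =
            - 1 * (int j * (int j - int p) + (- (int i * (int i + 1))) * (int p)\<^sup>2)"
      by (simp only: of_nat_add of_nat_mult) (simp add: algebra_simps power2_eq_square)
  qed
  also have "\<dots> = (\<Prod>j=1..N. int j * (int j - int p) + (- (int i * (int i + 1))) * (int p)\<^sup>2)"
    using p(4) by (subst prod.distrib) simp
  finally have "padic_Gamma_nat p (Suc i * p) = padic_Gamma_nat p (i * p) *
    - (\<Prod>j=1..N. int j * (int j - int p) + (- (int i * (int i + 1))) * (int p)\<^sup>2)"
    using padic_Gamma_nat_add[of p "i * p" p] by (simp only: mult_Suc add.commute)
  also have "[\<dots> = (- fact (p - 1)) ^ i * - fact (p - 1)] (mod int p ^ 3)"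
    by (intro cong_mult Suc.IH) (simp only: cong_minus_minus_iff half_product_perturbed_cong[OF p])
  finally show ?case by (simp only: power_Suc2)
qed simp

text \<open>
  For \<open>n < p\<close> no multiple of \<open>p\<close> lies between \<open>m\<close> and \<open>m + n = pb\<close>, so all \<open>n\<close> factors are present;
  the factor at distance \<open>j\<close> below \<open>pb\<close> contributes \<open>-(pb - j)\<close>.
\<close>

lemma padic_Gamma_nat_before_multiple:
  assumes "m + n = p * b" "n < p"
  shows "padic_Gamma_nat p (p * b) = padic_Gamma_nat p m * (\<Prod>j=1..n. int j - int p * int b)"
proof -
  have "(\<Prod>i<n. - (if p dvd m + i then 1 else int (m + i))) = (\<Prod>j=1..n. int j - int p * int b)"
  proof (rule prod.reindex_bij_witness[of _ "\<lambda>j. n - j" "\<lambda>i. n - i"])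
    fix i assume i: "i \<in> {..<n}"
    have "p dvd (m + i) + (n - i)" using i assms by simp
    moreover have "\<not> p dvd n - i" using i assms(2) by (auto dest: dvd_imp_le)
    ultimately have "\<not> p dvd m + i" using dvd_add_right_iff by blast
    moreover have "int m + int n = int p * int b" using assms(1) by (metis of_nat_add of_nat_mult)
    ultimately show "int (n - i) - int p * int b = - (if p dvd m + i then 1 else int (m + i))"
      using i by (simp add: of_nat_diff)
  qed auto
  thus ?thesis using padic_Gamma_nat_add[of p m n] assms(1) by simp
qed

section \<open>The congruence at one quarter as a congruence of integers\<close>

text \<open>
  From \<open>4n = p - 1\<close> and \<open>4b \<equiv> 1\<close> modulo \<open>p^2\<close> one gets \<open>2(2n - k - 2pb) \<equiv> -(2k + 1)\<close> modulo \<open>p^3\<close>; this identifies \<open>(1/2)\<^sub>n\<close>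
  with the upper half of \<open>\<Prod>j\<le>2n. (j - 2pb)\<close> up to sign.
\<close>

lemma odd_product_square_cong:
  fixes p n b :: nat
  assumes p: "p = 4 * n + 1" and b: "4 * int b = 3 * (int p)\<^sup>2 + 1"
  shows "[(\<Prod>k<n. 2 * int k + 1)\<^sup>2 =
          4 ^ n * (\<Prod>j=n+1..2*n. int j - 2 * (int p * int b))\<^sup>2] (mod int p ^ 3)"
proof -
  let ?P = "int p"
  let ?B = "\<Prod>j=n+1..2*n. int j - 2 * (?P * int b)"
  have "2 ^ n * ?B = (\<Prod>k<n. 2) * (\<Prod>k<n. int (2*n-k) - 2 * (?P * int b))"
    by (intro arg_cong2[where f = times]
          prod.reindex_bij_witness[of _ "\<lambda>k. 2*n-k" "\<lambda>j. 2*n-j"]) auto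
  also have "\<dots> = (\<Prod>k<n. 2 * (int (2*n-k) - 2 * (?P * int b)))"
    by (rule prod.distrib [symmetric])
  also have "\<dots> = (\<Prod>k<n. - 1 * ((2 * int k + 1) + 3 * ?P ^ 3))"
  proof (intro prod.cong refl)
    fix k assume "k \<in> {..<n}"
    hence k: "4 * int (2*n-k) = 2 * (?P - 1 - 2 * int k)" using p by (simp add: of_nat_diff)
    have "2 * (2 * (int (2*n-k) - 2 * (?P * int b))) = 4 * int (2*n-k) - 2 * (?P * (4 * int b))"
      by (simp add: algebra_simps)
    also have "\<dots> = 2 * (- 1 * ((2 * int k + 1) + 3 * ?P ^ 3))"
      unfolding k b by (simp add: algebra_simps power2_eq_square power3_eq_cube)
    finally show "2 * (int (2*n-k) - 2 * (?P * int b)) = - 1 * ((2 * int k + 1) + 3 * ?P ^ 3)"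
      by simp
  qed
  also have "\<dots> = (\<Prod>k<n. - 1) * (\<Prod>k<n. (2 * int k + 1) + 3 * ?P ^ 3)" by (rule prod.distrib)
  finally have "2 ^ n * ?B = (- 1) ^ n * (\<Prod>k<n. (2 * int k + 1) + 3 * ?P ^ 3)" by simp
  hence "(2 ^ n * ?B)\<^sup>2 = ((- 1) ^ n * (\<Prod>k<n. (2 * int k + 1) + 3 * ?P ^ 3))\<^sup>2" by simp
  moreover have "((2::int) ^ n)\<^sup>2 = 4 ^ n"
    by (subst power_mult [symmetric], subst mult.commute, subst power_mult) simp
  moreover have "((- 1 :: int) ^ n)\<^sup>2 = 1"
    by (simp flip: power_mult)
  ultimately have "4 ^ n * ?B\<^sup>2 = (\<Prod>k<n. (2 * int k + 1) + 3 * ?P ^ 3)\<^sup>2"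
    by (simp add: power_mult_distrib)
  also have "[\<dots> = (\<Prod>k<n. 2 * int k + 1)\<^sup>2] (mod ?P ^ 3)"
    by (intro cong_pow cong_prod) (simp add: cong_iff_dvd_diff)
  finally show ?thesis by (rule cong_sym)
qed

text \<open>
  \<open>j - Pb\<close> is the midpoint of \<open>j\<close> and \<open>j - 2Pb\<close>, so its square exceeds their product by the constant
  \<open>P^2 b^2\<close>. In the coefficient of this constant the products \<open>j(j - 2Pb)\<close> matter only modulo \<open>P\<close>, where they
  are \<open>j^2\<close>.
\<close>

lemma midpoint_product_square_cong:
  fixes P b :: int
  shows "[(\<Prod>j=1..n. int j - P * b)\<^sup>2 =
          fact n * (\<Prod>j=1..n. int j - 2 * (P * b)) +
          b\<^sup>2 * P\<^sup>2 * (\<Sum>k=1..n. \<Prod>j\<in>{1..n} - {k}. (int j)\<^sup>2)] (mod P ^ 3)"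
proof -
  let ?a = "\<lambda>j. int j * (int j - 2 * (P * b))" and ?x = "b\<^sup>2 * P\<^sup>2"
  let ?S' = "\<Sum>k=1..n. \<Prod>j\<in>{1..n} - {k}. ?a j"
  let ?S = "\<Sum>k=1..n. \<Prod>j\<in>{1..n} - {k}. (int j)\<^sup>2"
  have square: "(\<Prod>j=1..n. int j - P * b)\<^sup>2 = (\<Prod>j=1..n. ?a j + ?x)"
    unfolding prod_power_distrib by (intro prod.cong) (simp_all add: algebra_simps power2_eq_square)
  have expand: "[(\<Prod>j=1..n. ?a j + ?x) = (\<Prod>j=1..n. ?a j) + ?x * ?S'] (mod P ^ 3)"
  proof (rule cong_dvd_modulus[OF prod_add_const_cong])
    have "?x\<^sup>2 = P ^ 3 * (b ^ 4 * P)" by (simp add: eval_nat_numeral)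
    thus "P ^ 3 dvd ?x\<^sup>2" by (metis dvd_triv_left)
  qed simp
  have reduce: "[(\<Prod>j=1..n. ?a j) + ?x * ?S' = (\<Prod>j=1..n. ?a j) + ?x * ?S] (mod P ^ 3)"
  proof -
    have "[?S' = ?S] (mod P)"
    proof (intro cong_sum cong_prod)
      fix j
      have "?a j = (int j)\<^sup>2 + P * (- 2 * b * int j)" by (simp add: algebra_simps power2_eq_square)
      thus "[?a j = (int j)\<^sup>2] (mod P)" by (simp only: cong_iff_dvd_diff) simp
    qed
    then obtain t where t: "?S' - ?S = P * t" by (auto simp only: cong_iff_dvd_diff elim!: dvdE)
    have "?x * ?S' - ?x * ?S = ?x * (?S' - ?S)" by (simp only: right_diff_distrib)
    also have "\<dots> = P ^ 3 * (b\<^sup>2 * t)" unfolding t by (simp add: eval_nat_numeral)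
    finally have "P ^ 3 dvd ?x * ?S' - ?x * ?S" by (metis dvd_triv_left)
    thus ?thesis by (intro cong_add cong_refl) (simp only: cong_iff_dvd_diff)
  qed
  have "(\<Prod>j=1..n. ?a j) = fact n * (\<Prod>j=1..n. int j - 2 * (P * b))"
    by (simp add: prod.distrib fact_prod)
  with cong_trans[OF expand reduce] show ?thesis by (simp only: square)
qed

text \<open>
  Squaring the hypothesis on \<open>Q\<close> and using \<open>16 b^2 \<equiv> 1\<close> gives
  \<open>8 Q^4 \<equiv> F^2 (8 A^2 + P^2 S)\<close>; as \<open>A \<equiv> F\<close> modulo \<open>P\<close>, the factor \<open>8 F^2 - P^2 S\<close> cancels the term in \<open>S\<close>.
  In the application \<open>F = n!\<close> and \<open>S / F^2\<close> is the harmonic number.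
\<close>

lemma fourth_power_times_correction_cong:
  fixes P b F A S Q :: int
  assumes b: "4 * b = 3 * P\<^sup>2 + 1" and A: "[A = F] (mod P)"
    and Q: "[Q\<^sup>2 = F * A + b\<^sup>2 * P\<^sup>2 * S] (mod P ^ 3)"
  shows "[(8 * F\<^sup>2 - P\<^sup>2 * S) * (8 * Q ^ 4) = 64 * F ^ 4 * A\<^sup>2] (mod P ^ 3)"
proof -
  obtain t where t: "A = F + P * t"
    using A by (metis cong_iff_lin cong_sym mult.commute)
  have b16: "16 * b\<^sup>2 = (3 * P\<^sup>2 + 1)\<^sup>2" unfolding b [symmetric] by (simp add: power2_eq_square)
  have "[(8 * F\<^sup>2 - P\<^sup>2 * S) * (8 * (Q\<^sup>2)\<^sup>2) =
          (8 * F\<^sup>2 - P\<^sup>2 * S) * (8 * (F * A + b\<^sup>2 * P\<^sup>2 * S)\<^sup>2)] (mod P ^ 3)"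
    by (intro cong_mult cong_refl cong_pow Q)
  also have "8 * (F * A + b\<^sup>2 * P\<^sup>2 * S)\<^sup>2 =
      8 * (F * A)\<^sup>2 + (16 * b\<^sup>2) * P\<^sup>2 * S * F * A + P ^ 3 * (8 * b ^ 4 * P * S\<^sup>2)"
    by (simp add: algebra_simps eval_nat_numeral)
  also have "\<dots> = 8 * (F * A)\<^sup>2 + P\<^sup>2 * S * F * A
      + P ^ 3 * (8 * b ^ 4 * P * S\<^sup>2 + (9 * P ^ 3 + 6 * P) * S * F * A)"
    unfolding b16 by (simp add: algebra_simps eval_nat_numeral)
  also have "(8 * F\<^sup>2 - P\<^sup>2 * S) * \<dots> = 64 * F ^ 4 * A\<^sup>2 + 8 * P\<^sup>2 * S * F\<^sup>2 * A * (F - A)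
      + P ^ 3 * ((8 * F\<^sup>2 - P\<^sup>2 * S) * (8 * b ^ 4 * P * S\<^sup>2 + (9 * P ^ 3 + 6 * P) * S * F * A)
                 - P * S\<^sup>2 * F * A)"
    by (simp add: algebra_simps eval_nat_numeral)
  also have "8 * P\<^sup>2 * S * F\<^sup>2 * A * (F - A) = P ^ 3 * (- 8 * S * F\<^sup>2 * A * t)"
    unfolding t by (simp add: algebra_simps eval_nat_numeral)
  also have "(Q\<^sup>2)\<^sup>2 = Q ^ 4" by (simp flip: power_mult)
  finally show ?thesis by (rule cong_trans) (simp add: cong_iff_dvd_diff)
qed

text \<open>
  The integer form of the theorem, with \<open>m\<close> in the role of \<open>1/4\<close> and denominators cleared.
  Both sides are compared after multiplication by the unit \<open>8 Q^4\<close>.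
\<close>

lemma padic_Gamma_nat_quarter_fourth_power_cong:
  assumes p: "prime p" "p = 4 * n + 1" and m: "4 * m = 3 * p ^ 3 + 1"
  shows "[(\<Prod>k<n. 2 * int k + 1)\<^sup>2 *
            (8 * (fact n)\<^sup>2 - (int p)\<^sup>2 * (\<Sum>k=1..n. \<Prod>j\<in>{1..n} - {k}. (int j)\<^sup>2)) =
          - 8 * 4 ^ n * (fact n) ^ 4 * padic_Gamma_nat p m ^ 4] (mod int p ^ 3)"
proof -
  define P where "P = int p"
  \<comment> \<open>This is \<open>(3p^2 + 1)/4\<close>, the quotient \<open>(m + n)/p\<close>.\<close>
  define b where "b = 12 * n\<^sup>2 + 6 * n + 1"
  define F where "F = (fact n :: int)"
  define S where "S = (\<Sum>k=1..n. \<Prod>j\<in>{1..n} - {k}. (int j)\<^sup>2)"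
  define Q where "Q = (\<Prod>j=1..n. int j - P * int b)"
  define A where "A = (\<Prod>j=1..n. int j - 2 * (P * int b))"
  define B where "B = (\<Prod>j=n+1..2*n. int j - 2 * (P * int b))"
  define O1 where "O1 = (\<Prod>k<n. 2 * int k + 1)"
  define w where "w = - (fact (p - 1) :: int)"
  have "n \<noteq> 0" using p by (cases n) auto
  hence p3: "p > 3" using p(2) by simp
  have half: "p = 2 * (2 * n) + 1" "even (2 * n)" using p(2) by simp_all
  have b4_nat: "4 * b = 3 * p\<^sup>2 + 1"
    unfolding b_def p(2) by (simp add: algebra_simps power2_eq_square)
  have b4: "4 * int b = 3 * P\<^sup>2 + 1"
    using arg_cong[OF b4_nat, of int] by (simp add: P_def)
  have mn: "m + n = p * b"
  proof -
    have "4 * (m + n) = 3 * p ^ 3 + p" using m p(2) by simp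
    also have "\<dots> = p * (3 * p\<^sup>2 + 1)" by (simp add: algebra_simps power2_eq_square power3_eq_cube)
    also have "\<dots> = 4 * (p * b)" unfolding b4_nat [symmetric] by simp
    finally show ?thesis by simp
  qed
  have multiple: "[padic_Gamma_nat p (i * p) = w ^ i] (mod P ^ 3)" for i
    using padic_Gamma_nat_multiple_cong[OF p(1) p3 half] by (simp add: P_def w_def)
  have "odd p" using p(2) by simp
  \<comment> \<open>\<open>p^2 * p = p^3\<close> is both a multiple of \<open>p\<close> and a period, so the value there is computed in two ways.\<close>
  have "[w ^ p\<^sup>2 = 1] (mod P ^ 3)"
  proof -
    have "[padic_Gamma_nat p 0 = padic_Gamma_nat p (p ^ 3)] (mod P ^ 3)"
      using padic_Gamma_nat_mod_prime_power[OF p(1) \<open>odd p\<close>, of "p ^ 3" 3] by (simp add: P_def)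
    also have "p ^ 3 = p\<^sup>2 * p" by (simp add: power2_eq_square power3_eq_cube)
    also note multiple
    finally show ?thesis by (simp add: cong_sym)
  qed
  hence "[w ^ (3 * p\<^sup>2 + 1) = 1 ^ 3 * w] (mod P ^ 3)"
    by (simp only: power_add mult.commute[of 3] power_mult power_one_right)
       (intro cong_mult cong_pow cong_refl)
  hence w4: "[w ^ (4 * b) = w] (mod P ^ 3)" by (simp add: b4_nat)
  have "padic_Gamma_nat p (b * p) = padic_Gamma_nat p m * Q"
    using padic_Gamma_nat_before_multiple[OF mn] p(2) by (simp add: Q_def P_def mult.commute)
  with multiple[of b] have "[(padic_Gamma_nat p m * Q) ^ 4 = (w ^ b) ^ 4] (mod P ^ 3)"
    by (intro cong_pow) simp
  with w4 have gQ: "[(padic_Gamma_nat p m * Q) ^ 4 = w] (mod P ^ 3)"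
    by (simp add: cong_trans mult.commute flip: power_mult)
  \<comment> \<open>The square of \<open>j - 2pb\<close> is congruent to \<open>j(j - p) + 4p^2b^2\<close>, a uniform perturbation.\<close>
  have "(A * B)\<^sup>2 = (\<Prod>j=1..2*n. int j - 2 * (P * int b))\<^sup>2"
    unfolding A_def B_def by (subst prod.union_disjoint [symmetric]) (auto intro!: prod.cong arg_cong[where f="\<lambda>x. x\<^sup>2"])
  also have "\<dots> = (\<Prod>j=1..2*n. (int j - 2 * (P * int b))\<^sup>2)" by (rule prod_power_distrib)
  also have "[\<dots> = (\<Prod>j=1..2*n. int j * (int j - P) + 4 * (int b)\<^sup>2 * P\<^sup>2)] (mod P ^ 3)"
  proof (intro cong_prod)
    fix j
    have "(int j - 2 * (P * int b))\<^sup>2 =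
            int j * (int j - P * (4 * int b)) + 4 * (int b)\<^sup>2 * P\<^sup>2"
      by (simp add: algebra_simps power2_eq_square)
    also have "\<dots> = int j * (int j - P) + 4 * (int b)\<^sup>2 * P\<^sup>2 + P ^ 3 * (- 3 * int j)"
      unfolding b4 by (simp add: algebra_simps eval_nat_numeral)
    finally show "[(int j - 2 * (P * int b))\<^sup>2 =
                   int j * (int j - P) + 4 * (int b)\<^sup>2 * P\<^sup>2] (mod P ^ 3)"
      by (simp only: cong_iff_dvd_diff) simp
  qed
  also have "[(\<Prod>j=1..2*n. int j * (int j - P) + 4 * (int b)\<^sup>2 * P\<^sup>2) = - w] (mod P ^ 3)"
    using half_product_perturbed_cong[OF p(1) p3 half, of "4 * (int b)\<^sup>2"] by (simp add: P_def w_def)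
  finally have AB: "[(A * B)\<^sup>2 = - w] (mod P ^ 3)" .
  have "[A = F] (mod P)"
    unfolding A_def F_def fact_prod of_nat_prod by (intro cong_prod) (simp add: cong_iff_dvd_diff)
  hence correction: "[(8 * F\<^sup>2 - P\<^sup>2 * S) * (8 * Q ^ 4) = 64 * F ^ 4 * A\<^sup>2] (mod P ^ 3)"
    using fourth_power_times_correction_cong[OF b4 _ midpoint_product_square_cong[of P "int b" n, folded S_def Q_def A_def]]
    by (simp add: F_def)
  have O2: "[O1\<^sup>2 = 4 ^ n * B\<^sup>2] (mod P ^ 3)"
    unfolding O1_def B_def P_def using odd_product_square_cong[OF p(2)] b4 by (simp add: P_def)
  have "[(O1\<^sup>2 * (8 * F\<^sup>2 - P\<^sup>2 * S)) * (8 * Q ^ 4) = 4 ^ n * B\<^sup>2 * (64 * F ^ 4 * A\<^sup>2)] (mod P ^ 3)"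
    unfolding mult.assoc[of "O1\<^sup>2"] by (intro cong_mult O2 correction)
  also have "4 ^ n * B\<^sup>2 * (64 * F ^ 4 * A\<^sup>2) = 64 * 4 ^ n * F ^ 4 * (A * B)\<^sup>2"
    by (simp add: power_mult_distrib mult_ac)
  also have "[\<dots> = 64 * 4 ^ n * F ^ 4 * (- ((padic_Gamma_nat p m * Q) ^ 4))] (mod P ^ 3)"
  proof (intro cong_mult cong_refl)
    have "[- w = - ((padic_Gamma_nat p m * Q) ^ 4)] (mod P ^ 3)"
      using gQ by (simp only: cong_minus_minus_iff cong_sym)
    with AB show "[(A * B)\<^sup>2 = - ((padic_Gamma_nat p m * Q) ^ 4)] (mod P ^ 3)" by (rule cong_trans)
  qed
  also have "64 * 4 ^ n * F ^ 4 * (- ((padic_Gamma_nat p m * Q) ^ 4)) =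
               (- 8 * 4 ^ n * F ^ 4 * padic_Gamma_nat p m ^ 4) * (8 * Q ^ 4)"
    by (simp add: power_mult_distrib)
  finally have "[(O1\<^sup>2 * (8 * F\<^sup>2 - P\<^sup>2 * S)) * (8 * Q ^ 4) =
                 (- 8 * 4 ^ n * F ^ 4 * padic_Gamma_nat p m ^ 4) * (8 * Q ^ 4)] (mod P ^ 3)" .
  moreover have "coprime (8 * Q ^ 4) (P ^ 3)"
  proof -
    have "coprime (int j - P * int b) P" if "j \<in> {1..n}" for j
    proof -
      have "coprime (int j) P" unfolding P_def using that p by (intro coprime_less_prime) auto
      moreover have "[int j - P * int b = int j] (mod P)" by (simp add: cong_iff_dvd_diff)
      ultimately show ?thesis using cong_imp_coprime cong_sym by blast
    qed
    hence "coprime Q P" unfolding Q_def by (intro prod_coprime_left)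
    moreover have "coprime 8 P"
    proof -
      have "coprime 2 P" using \<open>odd p\<close> by (simp add: P_def)
      hence "coprime (2 * 2 * 2) P" by (simp only: coprime_mult_left_iff)
      thus ?thesis by simp
    qed
    ultimately show ?thesis by simp
  qed
  ultimately have "[O1\<^sup>2 * (8 * F\<^sup>2 - P\<^sup>2 * S) = - 8 * 4 ^ n * F ^ 4 * padic_Gamma_nat p m ^ 4] (mod P ^ 3)"
    by (simp only: cong_mult_rcancel)
  thus ?thesis by (simp only: O1_def F_def P_def S_def)
qed

section \<open>Coordinates of p-adic integers\<close>

lemma modular_inverse_prime_power_cong:
  assumes "coprime x (int p)" "coprime y (int p)" "[x = y] (mod int p ^ n)"
  shows "[(modular_inverse (int p ^ Suc n) x) = modular_inverse (int p ^ n) y] (mod int p ^ n)"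
proof -
  have "[x * modular_inverse (int p ^ Suc n) x = 1] (mod int p ^ Suc n)"
    using assms(1) by (intro cong_modular_inverse1) auto
  hence "[x * modular_inverse (int p ^ Suc n) x = 1] (mod int p ^ n)"
    by (rule cong_dvd_modulus) (simp add: le_imp_power_dvd)
  moreover have "[y * modular_inverse (int p ^ n) y = 1] (mod int p ^ n)"
    using assms(2) by (intro cong_modular_inverse1) auto
  moreover have "[x * modular_inverse (int p ^ n) y = y * modular_inverse (int p ^ n) y] (mod int p ^ n)"
    by (intro cong_mult cong_refl assms(3))
  ultimately have "[x * modular_inverse (int p ^ Suc n) x = x * modular_inverse (int p ^ n) y] (mod int p ^ n)"
    by (metis cong_sym cong_trans)
  thus ?thesis using assms(1) by (subst (asm) cong_mult_lcancel) auto
qed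

lemma padic_of_rat_in_carrier:
  assumes "p > 0" "coprime (snd (quotient_of q)) (int p)"
  shows "padic_of_rat p q \<in> carrier (padic_int_ring p)"
  unfolding padic_of_rat_def
  using assms by (intro padic_carrierI cong_mult cong_refl modular_inverse_prime_power_cong)

lemma padic_UnitsI:
  assumes p: "p > 0" and x: "x \<in> carrier (padic_int_ring p)" and cop: "\<And>n. coprime (x n) (int p ^ n)"
  shows "x \<in> Units (padic_int_ring p)"
proof -
  let ?R = "padic_int_ring p"
  interpret cring ?R using p by (rule cring_padic_int_ring)
  have cop': "coprime (x (Suc n)) (int p)" for n using cop[of "Suc n"] by simp
  let ?y = "\<lambda>n. modular_inverse (int p ^ n) (x n) mod int p ^ n"
  have "?y \<in> carrier ?R"
  proof (rule padic_carrierI[OF p])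
    fix n
    show "[(modular_inverse (int p ^ Suc n) (x (Suc n))) = modular_inverse (int p ^ n) (x n)] (mod int p ^ n)"
    proof (cases n)
      case (Suc m)
      with cop'[of m] cop'[of n] padic_carrier_cong[OF x, of n] show ?thesis
        by (intro modular_inverse_prime_power_cong) auto
    qed simp
  qed
  moreover have "?y \<otimes>\<^bsub>?R\<^esub> x = \<one>\<^bsub>?R\<^esub>"
  proof
    fix n
    show "(?y \<otimes>\<^bsub>?R\<^esub> x) n = \<one>\<^bsub>?R\<^esub> n"
      using cong_modular_inverse2[OF cop[of n]] by (simp add: padic_int_ring_def cong_def mod_simps)
  qed
  ultimately show ?thesis using x m_comm unfolding Units_def by fastforce
qed

text \<open>
  Allows \<open>p\<close>-integrality to be read off from any fraction representing \<open>q\<close>, not only the reduced one.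
\<close>

lemma coprime_denominator:
  assumes "coprime d (int p)" "q * of_int d = of_int a"
  shows "coprime (snd (quotient_of q)) (int p)"
proof -
  obtain x y where xy: "quotient_of q = (x, y)" by fastforce
  hence y: "y > 0" "coprime x y" and q: "q = of_int x / of_int y"
    by (simp_all add: quotient_of_denom_pos quotient_of_coprime quotient_of_div)
  have "(of_int x :: rat) = q * of_int y" using q y by simp
  hence "of_int (x * d) = (of_int (a * y) :: rat)" by (simp add: mult_ac flip: assms(2))
  hence "x * d = a * y" by (simp only: of_int_eq_iff)
  hence "y dvd x * d" by simp
  hence "y dvd d" using y(2) by (simp add: coprime_commute coprime_dvd_mult_right_iff)
  thus ?thesis using assms(1) xy by (simp add: coprime_divisors[OF _ dvd_refl])
qed

lemma denominator_times_padic_of_rat: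
  assumes "coprime d (int p)" "q * of_int d = of_int a"
  shows "[d * padic_of_rat p q n = a] (mod int p ^ n)"
proof -
  obtain x y where xy: "quotient_of q = (x, y)" by fastforce
  hence y: "y > 0" and q: "q = of_int x / of_int y"
    by (simp_all add: quotient_of_denom_pos quotient_of_div)
  have cop: "coprime y (int p ^ n)" using coprime_denominator[OF assms] xy by simp
  have "(of_int x :: rat) = q * of_int y" using q y by simp
  hence "of_int (x * d) = (of_int (a * y) :: rat)" by (simp add: mult_ac flip: assms(2))
  hence eq: "x * d = a * y" by (simp only: of_int_eq_iff)
  have "[d * padic_of_rat p q n = d * (x * modular_inverse (int p ^ n) y)] (mod int p ^ n)"
    unfolding padic_of_rat_def using xy by (intro cong_mult cong_refl) simp
  also have "d * (x * modular_inverse (int p ^ n) y) = a * (y * modular_inverse (int p ^ n) y)"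
    using eq by (metis mult.assoc mult.commute)
  also have "[\<dots> = a * 1] (mod int p ^ n)"
    using cop by (intro cong_mult cong_refl cong_modular_inverse1)
  finally show ?thesis by simp
qed

lemma padic_of_rat_of_nat: "padic_of_rat p (of_nat k) = (\<lambda>n. int k mod int p ^ n)"
  using padic_of_rat_of_int[of p "int k"] by simp

lemma padic_minus_apply:
  assumes "p > 0" "x \<in> carrier (padic_int_ring p)"
  shows "(\<ominus>\<^bsub>padic_int_ring p\<^esub> x) n = (- x n) mod int p ^ n"
proof -
  interpret cring "padic_int_ring p" using assms by (intro cring_padic_int_ring)
  let ?y = "\<lambda>n. (- x n) mod int p ^ n"
  have "?y \<in> carrier (padic_int_ring p)"
    using assms by (intro padic_carrierI) (simp_all add: cong_minus_minus_iff padic_carrier_cong)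
  moreover have "?y \<oplus>\<^bsub>padic_int_ring p\<^esub> x = \<zero>\<^bsub>padic_int_ring p\<^esub>"
    by (simp add: padic_int_ring_def mod_simps)
  ultimately have "\<ominus>\<^bsub>padic_int_ring p\<^esub> x = ?y"
    using assms(2) by (intro minus_equality)
  thus ?thesis by simp
qed

lemma padic_pow_apply: "(x [^]\<^bsub>padic_int_ring p\<^esub> (k::nat)) n mod int p ^ n = x n ^ k mod int p ^ n"
proof (induction k)
  case (Suc k)
  have "(x [^]\<^bsub>padic_int_ring p\<^esub> Suc k) n = (x [^]\<^bsub>padic_int_ring p\<^esub> k) n * x n mod int p ^ n"
    by (simp add: nat_pow_def padic_int_ring_def)
  with Suc show ?case by (metis mod_mod_trivial mod_mult_left_eq power_Suc2)
qed (simp add: nat_pow_def padic_int_ring_def)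

text \<open>
  If the coordinate of \<open>z = x - y\<close> at \<open>k\<close> vanishes then \<open>p^k\<close> divides all later ones, and the shifted sequence
  \<open>z (k + n) / p^k\<close> is a \<open>p\<close>-adic integer whose product with \<open>p^k\<close> is \<open>z\<close>.
\<close>

lemma padic_cong_if_coordinate_eq:
  assumes p: "p > 0" and xy: "x \<in> carrier (padic_int_ring p)" "y \<in> carrier (padic_int_ring p)"
    and eq: "x k = y k"
  shows "padic_cong p k x y"
proof -
  let ?R = "padic_int_ring p" and ?P = "int p"
  interpret cring ?R using p by (rule cring_padic_int_ring)
  define z where "z = x \<ominus>\<^bsub>?R\<^esub> y"
  have z: "z \<in> carrier ?R" unfolding z_def using xy by (rule minus_closed)
  have "z n = (x n - y n) mod ?P ^ n" for n
    using padic_minus_apply[OF p xy(2), of n]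
    by (simp add: z_def a_minus_def padic_int_ring_def mod_simps)
  hence zk: "z k = 0" using eq by simp
  have "z (k + n) mod ?P ^ k = 0" for n
  proof (induction n)
    case (Suc n)
    have "[z (Suc (k + n)) = z (k + n)] (mod ?P ^ (k + n))" using z by (rule padic_carrier_cong)
    hence "[z (Suc (k + n)) = z (k + n)] (mod ?P ^ k)"
      by (rule cong_dvd_modulus) (simp add: le_imp_power_dvd)
    with Suc show ?case by (simp add: cong_def)
  qed (simp add: zk)
  hence dvd: "?P ^ k dvd z (k + n)" for n by (simp add: mod_eq_0_iff_dvd)
  define u where "u n = z (k + n) div ?P ^ k" for n
  have u: "z (k + n) = ?P ^ k * u n" for n using dvd by (simp add: u_def)
  let ?u = "\<lambda>n. u n mod ?P ^ n"
  have "?u \<in> carrier ?R"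
  proof (rule padic_carrierI[OF p])
    fix n
    have "[z (Suc (k + n)) = z (k + n)] (mod ?P ^ (k + n))" using z by (rule padic_carrier_cong)
    hence "?P ^ k * ?P ^ n dvd ?P ^ k * (u (Suc n) - u n)"
      using u[of n] u[of "Suc n"] by (simp add: cong_iff_dvd_diff power_add right_diff_distrib)
    thus "[u (Suc n) = u n] (mod ?P ^ n)" using p by (simp add: cong_iff_dvd_diff)
  qed
  moreover have "z = ?u \<otimes>\<^bsub>?R\<^esub> padic_of_rat p (of_nat (p ^ k))"
  proof
    fix n
    have "[z (n + k) = z n] (mod ?P ^ n)"
    proof (induction k)
      case (Suc k)
      have "[z (Suc (n + k)) = z (n + k)] (mod ?P ^ (n + k))" using z by (rule padic_carrier_cong)
      hence "[z (Suc (n + k)) = z (n + k)] (mod ?P ^ n)"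
        by (rule cong_dvd_modulus) (simp add: le_imp_power_dvd)
      also note Suc
      finally show ?case by simp
    qed simp
    hence "z n = (u n * ?P ^ k) mod ?P ^ n"
      using padic_carrier_mod[OF z, of n] u[of n] by (simp add: cong_def add.commute mult.commute)
    thus "z n = (?u \<otimes>\<^bsub>?R\<^esub> padic_of_rat p (of_nat (p ^ k))) n"
      unfolding padic_of_rat_of_nat by (simp add: padic_int_ring_def mod_simps)
  qed
  ultimately show ?thesis unfolding padic_cong_def cgenideal_def z_def by blast
qed

section \<open>Existence and uniqueness of the p-adic Gamma function\<close>

text \<open>
  The coordinate \<open>x n\<close> is itself a natural number congruent to \<open>x\<close> modulo \<open>p^n\<close>, so it can serve as the
  argument at precision \<open>n\<close>.
\<close>

definition morita_Gamma :: "nat \<Rightarrow> (nat \<Rightarrow> int) \<Rightarrow> nat \<Rightarrow> int" where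
  "morita_Gamma p = (\<lambda>x\<in>carrier (padic_int_ring p). \<lambda>n. padic_Gamma_nat p (nat (x n)) mod int p ^ n)"

lemma padic_of_nat_in_carrier:
  assumes "p > 0"
  shows "padic_of_rat p (of_nat m) \<in> carrier (padic_int_ring p)"
  unfolding padic_of_rat_of_nat using assms by (intro padic_carrierI) auto

lemma morita_Gamma_of_nat:
  assumes p: "prime p" "odd p"
  shows "morita_Gamma p (padic_of_rat p (of_nat m)) = padic_of_rat p (of_int (padic_Gamma_nat p m))"
proof
  fix n
  have "nat (int m mod int p ^ n) = m mod p ^ n" by (simp flip: of_nat_power zmod_int)
  moreover have "padic_of_rat p (of_nat m) \<in> carrier (padic_int_ring p)"
    using prime_gt_0_nat[OF p(1)] by (rule padic_of_nat_in_carrier)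
  ultimately have "morita_Gamma p (padic_of_rat p (of_nat m)) n = padic_Gamma_nat p (m mod p ^ n) mod int p ^ n"
    by (simp add: morita_Gamma_def padic_of_rat_of_nat)
  also have "\<dots> = padic_Gamma_nat p m mod int p ^ n"
    using padic_Gamma_nat_mod_prime_power[OF p] by (simp add: cong_def)
  finally show "morita_Gamma p (padic_of_rat p (of_nat m)) n = padic_of_rat p (of_int (padic_Gamma_nat p m)) n"
    by (simp add: padic_of_rat_of_int)
qed

lemma morita_Gamma_in_carrier:
  assumes p: "prime p" "odd p" and x: "x \<in> carrier (padic_int_ring p)"
  shows "morita_Gamma p x \<in> carrier (padic_int_ring p)"
proof -
  have "[padic_Gamma_nat p (nat (x (Suc n))) = padic_Gamma_nat p (nat (x n))] (mod int p ^ n)" for n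
  proof -
    have "x n = x (Suc n) mod int p ^ n" "x (Suc n) \<ge> 0"
      using x by (simp_all add: padic_int_ring_def)
    hence "nat (x n) = nat (x (Suc n)) mod p ^ n"
      by (simp add: nat_mod_distrib nat_power_eq)
    thus ?thesis using padic_Gamma_nat_mod_prime_power[OF p] by (metis cong_sym)
  qed
  thus ?thesis using x prime_gt_0_nat[OF p(1)]
    by (simp add: morita_Gamma_def padic_carrierI)
qed

lemma is_padic_Gamma_morita_Gamma:
  assumes p: "prime p" "odd p"
  shows "is_padic_Gamma p (morita_Gamma p)"
  unfolding is_padic_Gamma_def
proof (intro conjI allI impI PiE_I)
  let ?R = "padic_int_ring p"
  have p0: "p > 0" using p by (simp add: prime_gt_0_nat)
  show "morita_Gamma p x \<in> Units ?R" if x: "x \<in> carrier ?R" for x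
  proof (intro padic_UnitsI p0 morita_Gamma_in_carrier p x)
    fix n
    have "coprime (padic_Gamma_nat p (nat (x n))) (int p ^ n)" using coprime_padic_Gamma_nat[OF p(1)] by simp
    hence "coprime (padic_Gamma_nat p (nat (x n)) mod int p ^ n) (int p ^ n)"
      using p0 by (subst coprime_mod_left_iff) auto
    thus "coprime (morita_Gamma p x n) (int p ^ n)" using x
      by (simp only: morita_Gamma_def restrict_apply')
  qed
  show "morita_Gamma p x = undefined" if "x \<notin> carrier ?R" for x
    using that by (simp add: morita_Gamma_def)
  show "continuous_on (carrier ?R) (morita_Gamma p)"
  proof (rule continuous_on_coordinatewise_then_product)
    fix n
    have "continuous_on (carrier ?R) ((\<lambda>k. padic_Gamma_nat p (nat k) mod int p ^ n) \<circ> (\<lambda>x. x n))"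
      by (intro continuous_on_compose continuous_on_discrete)
         (rule continuous_on_subset[OF continuous_on_product_coordinates subset_UNIV])
    thus "continuous_on (carrier ?R) (\<lambda>x. morita_Gamma p x n)"
      by (rule continuous_on_eq) (simp add: morita_Gamma_def)
  qed
  show "morita_Gamma p \<zero>\<^bsub>?R\<^esub> = \<one>\<^bsub>?R\<^esub>"
    using morita_Gamma_of_nat[OF p, of 0] padic_of_rat_of_nat[of p 0] padic_of_rat_of_int[of p 1]
    by (simp add: padic_int_ring_def)
  show "morita_Gamma p (padic_of_rat p (of_nat m)) =
          padic_of_rat p ((- 1) ^ m * (\<Prod>j | 1 \<le> j \<and> j < m \<and> \<not> p dvd j. of_nat j))" for m
    unfolding morita_Gamma_of_nat[OF p] by (simp add: padic_Gamma_nat_def)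
qed

text \<open>
  In the product topology it suffices that each coordinate is eventually constant.
\<close>

lemma padic_of_nat_tendsto:
  assumes x: "x \<in> carrier (padic_int_ring p)"
  shows "(\<lambda>k. padic_of_rat p (of_nat (nat (x k)))) \<longlonglongrightarrow> x"
proof -
  have "(\<lambda>k. padic_of_rat p (of_nat (nat (x k))) n) \<longlonglongrightarrow> x n" for n
  proof (rule tendsto_eventually, rule eventually_sequentiallyI[of n])
    fix k assume "n \<le> k"
    have "[x k = x n] (mod int p ^ n)"
      using \<open>n \<le> k\<close>
    proof (induction rule: dec_induct)
      case (step k)
      have "[x (Suc k) = x k] (mod int p ^ k)" using x by (rule padic_carrier_cong)
      hence "[x (Suc k) = x k] (mod int p ^ n)"
        by (rule cong_dvd_modulus) (simp add: le_imp_power_dvd step.hyps)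
      thus ?case using step.IH by (rule cong_trans)
    qed simp
    moreover have "x k \<ge> 0" using x by (simp add: padic_int_ring_def)
    ultimately show "padic_of_rat p (of_nat (nat (x k))) n = x n"
      unfolding padic_of_rat_of_nat using padic_carrier_mod[OF x, of n] by (simp add: cong_def)
  qed
  hence "limitin (product_topology (\<lambda>i. euclidean) UNIV)
           (\<lambda>k. padic_of_rat p (of_nat (nat (x k)))) x sequentially"
    by (simp add: limitin_componentwise)
  thus ?thesis by (simp add: euclidean_product_topology)
qed

text \<open>
  Both functions agree on the dense set of natural numbers and are continuous; limits are compared in
  each coordinate, where the topology is discrete.
\<close>

lemma is_padic_Gamma_unique:
  assumes "p > 0" and G: "is_padic_Gamma p G" and H: "is_padic_Gamma p H"
  shows "G = H"
proof
  let ?R = "padic_int_ring p"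
  fix x
  show "G x = H x"
  proof (cases "x \<in> carrier ?R")
    case True
    define X where "X k = padic_of_rat p (of_nat (nat (x k)))" for k
    have X: "X k \<in> carrier ?R" for k
      unfolding X_def using assms(1) by (rule padic_of_nat_in_carrier)
    have eq: "G (X k) = H (X k)" for k
    proof (cases "nat (x k) = 0")
      case True
      hence "X k = \<zero>\<^bsub>?R\<^esub>"
        using padic_of_rat_of_nat[of p 0] by (simp add: X_def padic_int_ring_def)
      thus ?thesis using G H by (simp add: is_padic_Gamma_def)
    next
      case False
      hence "nat (x k) \<ge> 1" by simp
      moreover have "\<forall>m\<ge>1. G (padic_of_rat p (of_nat m)) = H (padic_of_rat p (of_nat m))"
        using G H by (simp add: is_padic_Gamma_def)
      ultimately show ?thesis unfolding X_def by blast
    qed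
    have lim: "(\<lambda>k. F (X k) n) \<longlonglongrightarrow> F x n" if "is_padic_Gamma p F" for F n
    proof (rule continuous_on_tendsto_compose[where f = "\<lambda>x. F x n" and g = X])
      have "continuous_on (carrier ?R) F" using that unfolding is_padic_Gamma_def by blast
      thus "continuous_on (carrier ?R) (\<lambda>x. F x n)"
        by (rule continuous_on_product_then_coordinatewise)
      show "X \<longlonglongrightarrow> x" unfolding X_def using True by (rule padic_of_nat_tendsto)
    qed (simp_all add: True X)
    show ?thesis
    proof
      fix n
      show "G x n = H x n" using lim[OF G, of n] lim[OF H, of n] unfolding eq by (rule LIMSEQ_unique)
    qed
  next
    case False
    have "F x = undefined" if "is_padic_Gamma p F" for F
    proof -
      have "F \<in> carrier ?R \<rightarrow>\<^sub>E Units ?R" using that unfolding is_padic_Gamma_def by blast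
      thus ?thesis using False by (rule PiE_arb)
    qed
    thus ?thesis using G H by simp
  qed
qed

lemma padic_Gamma_eq_morita_Gamma:
  assumes "prime p" "odd p"
  shows "padic_Gamma p = morita_Gamma p"
  unfolding padic_Gamma_def
proof (rule the_equality)
  show "is_padic_Gamma p (morita_Gamma p)" using assms by (rule is_padic_Gamma_morita_Gamma)
  show "G = morita_Gamma p" if "is_padic_Gamma p G" for G
    using prime_gt_0_nat[OF assms(1)] that is_padic_Gamma_morita_Gamma[OF assms]
    by (rule is_padic_Gamma_unique)
qed

section \<open>The congruence for the p-adic Gamma function\<close>

text \<open>
  Turns the harmonic number into the integer sum of the second-order expansions.
\<close>

lemma fact_squared_harmonic2:
  "(fact n)\<^sup>2 * harmonic2 n = of_int (\<Sum>k=1..n. \<Prod>j\<in>{1..n} - {k}. (int j)\<^sup>2)"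
proof -
  have "(fact n)\<^sup>2 * (1 / (of_nat k)\<^sup>2) = (of_int (\<Prod>j\<in>{1..n} - {k}. (int j)\<^sup>2) :: rat)"
    if "k \<in> {1..n}" for k
  proof -
    have "(fact n)\<^sup>2 = (\<Prod>j=1..n. (of_nat j)\<^sup>2 :: rat)" by (simp add: fact_prod prod_power_distrib)
    also have "\<dots> = (of_nat k)\<^sup>2 * (\<Prod>j\<in>{1..n} - {k}. (of_nat j)\<^sup>2)"
      using that by (intro prod.remove) auto
    finally show ?thesis using that by simp
  qed
  thus ?thesis by (simp add: harmonic2_def sum_distrib_left)
qed

lemma power_two_pochhammer_half:
  "2 ^ n * pochhammer (1/2) n = (of_int (\<Prod>k<n. 2 * int k + 1) :: rat)"
proof (induction n)
  case (Suc n)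
  have "2 ^ Suc n * pochhammer (1/2) (Suc n) =
          (2 ^ n * pochhammer (1/2) n) * (2 * (1/2 + of_nat n) :: rat)"
    by (simp add: pochhammer_rec' algebra_simps)
  also have "2 * (1/2 + of_nat n) = (of_int (2 * int n + 1) :: rat)" by simp
  finally show ?case unfolding Suc by simp
qed simp

lemma coprime_fact_prime:
  assumes "prime p" "n < p"
  shows "coprime (fact n) (int p)"
  unfolding fact_prod of_nat_prod using assms
  by (intro prod_coprime_left coprime_less_prime) auto

text \<open>
  For \<open>p > 1\<close> one has \<open>m < p^3\<close>, so \<open>m\<close> is the coordinate itself and not only congruent to it.
\<close>

lemma padic_of_rat_quarter:
  assumes p: "odd p" "p > 1" and m: "4 * m = 3 * p ^ 3 + 1"
  shows "padic_of_rat p (1/4) 3 = int m"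
proof -
  let ?x = "padic_of_rat p (1/4) 3"
  have cop: "coprime 4 (int p)"
  proof -
    have "coprime (2 * 2) (int p)" using p(1) by (simp only: coprime_mult_left_iff) simp
    thus ?thesis by simp
  qed
  have "[4 * ?x = 1] (mod int p ^ 3)"
    using cop by (intro denominator_times_padic_of_rat) auto
  moreover have "[4 * int m = 1] (mod int p ^ 3)"
    using arg_cong[OF m, of int] by (simp add: cong_iff_dvd_diff)
  ultimately have "[4 * ?x = 4 * int m] (mod int p ^ 3)" by (metis cong_sym cong_trans)
  hence "[?x = int m] (mod int p ^ 3)" using cop by (subst (asm) cong_mult_lcancel) auto
  moreover have "?x mod int p ^ 3 = ?x" by (simp add: padic_of_rat_def)
  moreover have "int m mod int p ^ 3 = int m"
  proof -
    have "p ^ 3 > 1" using one_less_power[OF p(2), of 3] by simp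
    hence "m < p ^ 3" using m by linarith
    hence "int m < int p ^ 3" by (metis of_nat_less_iff of_nat_power)
    thus ?thesis by simp
  qed
  ultimately show ?thesis by (simp add: cong_def)
qed

theorem proposition1p3:
  fixes p :: nat
  assumes "prime p" and "odd p" and "[p = 1] (mod 4)"
  shows "padic_cong p 3
    (padic_of_rat p
       ((pochhammer (1/2) ((p - 1) div 4))\<^sup>2 / (fact ((p - 1) div 4))\<^sup>2
         * (1 - (of_nat p)\<^sup>2 / 8 * harmonic2 ((p - 1) div 4))))
    (\<ominus>\<^bsub>padic_int_ring p\<^esub>
       (padic_Gamma p (padic_of_rat p (1/4)) [^]\<^bsub>padic_int_ring p\<^esub> (4::nat)))"
proof -
  define n where "n = (p - 1) div 4"
  define m where "m = (3 * p ^ 3 + 1) div 4"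
  define O1 where "O1 = (\<Prod>k<n. 2 * int k + 1)"
  define S where "S = (\<Sum>k=1..n. \<Prod>j\<in>{1..n} - {k}. (int j)\<^sup>2)"
  define N where "N = O1\<^sup>2 * (8 * (fact n)\<^sup>2 - (int p)\<^sup>2 * S)"
  define D where "D = 8 * 4 ^ n * (fact n :: int) ^ 4"
  define q :: rat where "q = (pochhammer (1/2) n)\<^sup>2 / (fact n)\<^sup>2 * (1 - (of_nat p)\<^sup>2 / 8 * harmonic2 n)"
  let ?R = "padic_int_ring p" and ?x = "padic_of_rat p q"
  have p0: "p > 0" using assms(1) by (rule prime_gt_0_nat)
  interpret cring ?R using p0 by (rule cring_padic_int_ring)
  have p4: "p = 4 * n + 1"
  proof -
    have "p mod 4 = 1" using assms(3) by (simp add: cong_def)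
    thus ?thesis unfolding n_def by presburger
  qed
  have m4: "4 * m = 3 * p ^ 3 + 1"
  proof -
    have "[3 * p ^ 3 + 1 = 3 * 1 ^ 3 + 1] (mod 4)" by (intro cong_add cong_mult cong_pow cong_refl assms(3))
    hence "4 dvd 3 * p ^ 3 + 1" by (simp add: cong_def mod_eq_0_iff_dvd)
    thus ?thesis by (simp add: m_def)
  qed
  have cop: "coprime D (int p)"
  proof -
    have two: "coprime 2 (int p)" using assms(2) by simp
    have "coprime (2 * 2 * 2 * (2 * 2) ^ n * (fact n) ^ 4) (int p)"
      using coprime_fact_prime[OF assms(1), of n] p4 two
      by (simp only: coprime_mult_left_iff coprime_power_left_iff) simp
    thus ?thesis by (simp add: D_def)
  qed
  have "q * of_int D = of_int N"
  proof -
    have "q * of_int D = (2 ^ n * pochhammer (1/2) n)\<^sup>2 *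
            (8 * (fact n)\<^sup>2 - (of_nat p)\<^sup>2 * ((fact n)\<^sup>2 * harmonic2 n))"
    proof -
      have "(4 :: rat) ^ n = (2 ^ n)\<^sup>2"
        by (subst power_mult [symmetric], subst mult.commute, subst power_mult) simp
      thus ?thesis by (simp add: q_def D_def field_simps eval_nat_numeral)
    qed
    thus ?thesis unfolding power_two_pochhammer_half fact_squared_harmonic2
      by (simp add: N_def O1_def S_def)
  qed
  note q = cop this
  have x: "?x \<in> carrier ?R" using p0 coprime_denominator[OF q] by (rule padic_of_rat_in_carrier)
  have quarter: "padic_of_rat p (1/4) \<in> carrier ?R"
  proof (rule padic_of_rat_in_carrier[OF p0 coprime_denominator])
    have "coprime (2 * 2) (int p)" using assms(2) by (simp only: coprime_mult_left_iff) simp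
    thus "coprime 4 (int p)" by simp
    show "1 / 4 * of_int 4 = (of_int 1 :: rat)" by simp
  qed
  define g where "g = padic_Gamma p (padic_of_rat p (1/4))"
  have g: "g \<in> carrier ?R" "g 3 = padic_Gamma_nat p m mod int p ^ 3"
    using quarter padic_of_rat_quarter[OF assms(2) prime_gt_1_nat[OF assms(1)] m4] morita_Gamma_in_carrier[OF assms(1,2) quarter]
    unfolding g_def padic_Gamma_eq_morita_Gamma[OF assms(1,2)] by (simp_all add: morita_Gamma_def)
  have "[D * ?x 3 = N] (mod int p ^ 3)" using q by (rule denominator_times_padic_of_rat)
  also have "[N = D * - (padic_Gamma_nat p m ^ 4)] (mod int p ^ 3)"
    using padic_Gamma_nat_quarter_fourth_power_cong[OF assms(1) p4 m4] by (simp add: N_def D_def O1_def S_def)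
  finally have "[?x 3 = - (padic_Gamma_nat p m ^ 4)] (mod int p ^ 3)"
    using cop by (subst (asm) cong_mult_lcancel) auto
  moreover have "(\<ominus>\<^bsub>?R\<^esub> (g [^]\<^bsub>?R\<^esub> (4::nat))) 3 = - (padic_Gamma_nat p m ^ 4) mod int p ^ 3"
  proof -
    have "(\<ominus>\<^bsub>?R\<^esub> (g [^]\<^bsub>?R\<^esub> (4::nat))) 3 = - (g [^]\<^bsub>?R\<^esub> (4::nat)) 3 mod int p ^ 3"
      using p0 g(1) by (intro padic_minus_apply) auto
    also have "\<dots> = - (g 3 ^ 4) mod int p ^ 3"
      using padic_pow_apply[where x = g and k = 4 and n = 3 and p = p] by (metis mod_minus_eq)
    also have "\<dots> = - (padic_Gamma_nat p m ^ 4) mod int p ^ 3"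
      unfolding g(2) by (metis mod_minus_eq power_mod)
    finally show ?thesis .
  qed
  ultimately have "?x 3 = (\<ominus>\<^bsub>?R\<^esub> (g [^]\<^bsub>?R\<^esub> (4::nat))) 3"
    using padic_carrier_mod[OF x, of 3] by (simp add: cong_def)
  hence "padic_cong p 3 ?x (\<ominus>\<^bsub>?R\<^esub> (g [^]\<^bsub>?R\<^esub> (4::nat)))"
    using p0 x g(1) by (intro padic_cong_if_coordinate_eq) auto
  thus ?thesis unfolding q_def g_def n_def .
qed

end
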